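(* Let $p$ be a prime number and let $G = \mathbb{Z}_p$ be the field with $p$ elements. There exist locally compact connected topological spaces $X$ and $T$ and two points $r, s \in T$ such that the embeddings $$F_r : X \to X \times T, \quad F_r(x) = (x, r), \qquad F_s : X \to X \times T, \quad F_s(x) = (x, s),$$ induce different homomorphisms in cohomology, i.e. $$F_r^{*} \neq F_s^{*} : H^{*}(X \times T; G) \to H^{*}(X; G).$$
   Context: $H^{*}(\,\cdot\,; G)$ denotes Alexander–Spanier–Kolmogoroff cohomology (i.e. Alexander–Spanier cohomology) with coefficients in the abelian group $G$; for paracompact spaces it is equivalent to Aleksandroff–Čech cohomology. For a continuous map $f : X \to Y$, $f^{*} : H^{*}(Y; G) \to H^{*}(X; G)$ denotes the induced homomorphism. The product $X \times T$ carries the product topology. *)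

theory Defs
  imports
    "HOL-Analysis.Analysis"
    "HOL-Algebra.FiniteProduct"
    "HOL-Algebra.Product_Groups"
    "HOL-Algebra.Elementary_Groups"
    "HOL-Computational_Algebra.Primes"
begin

text \<open>
  Alexander--Spanier cohomology of a space \<open>X\<close> with coefficients in an abelian group \<open>G\<close>
  (written multiplicatively, as always in HOL-Algebra): the cohomology of the quotient
  complex \<open>C\<^sup>n(X;G) / C\<^sub>0\<^sup>n(X;G)\<close>, where \<open>C\<^sup>n(X;G)\<close> consists of all functions
  \<open>X\<^sup>n\<^sup>+\<^sup>1 \<rightarrow> G\<close>, without any continuity, and \<open>C\<^sub>0\<^sup>n(X;G)\<close> of those vanishing on some
  neighbourhood of the diagonal. An \<open>(n+1)\<close>-tuple \<open>(x\<^sub>0, \<dots>, x\<^sub>n)\<close> is a list of length \<open>n + 1\<close>.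
\<close>

definition as_simplices :: "'a topology \<Rightarrow> nat \<Rightarrow> 'a list set" where
  "as_simplices X n = {xs. length xs = Suc n \<and> set xs \<subseteq> topspace X}"

definition as_cochain_group ::
    "'a topology \<Rightarrow> ('g, 'm) monoid_scheme \<Rightarrow> nat \<Rightarrow> ('a list \<Rightarrow> 'g) monoid" where
  "as_cochain_group X G n = product_group (as_simplices X n) (\<lambda>_. G)"

definition as_locally_zero ::
    "'a topology \<Rightarrow> ('g, 'm) monoid_scheme \<Rightarrow> nat \<Rightarrow> ('a list \<Rightarrow> 'g) set" where
  "as_locally_zero X G n =
     {\<phi> \<in> carrier (as_cochain_group X G n).
        \<exists>\<U>. (\<forall>U\<in>\<U>. openin X U) \<and> \<Union>\<U> = topspace X \<and>
            (\<forall>U\<in>\<U>. \<forall>xs\<in>as_simplices X n. set xs \<subseteq> U \<longrightarrow> \<phi> xs = \<one>\<^bsub>G\<^esub>)}"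

definition as_complex ::
    "'a topology \<Rightarrow> ('g, 'm) monoid_scheme \<Rightarrow> nat \<Rightarrow> ('a list \<Rightarrow> 'g) set monoid" where
  "as_complex X G n = as_cochain_group X G n Mod as_locally_zero X G n"

definition omit_vertex :: "nat \<Rightarrow> 'a list \<Rightarrow> 'a list" where
  "omit_vertex i xs = take i xs @ drop (Suc i) xs"

text \<open>
  \<open>(\<delta>\<phi>)(x\<^sub>0, \<dots>, x\<^bsub>n+1\<^esub>) = \<Sum>i\<le>n+1. (-1)\<^sup>i \<phi>(x\<^sub>0, \<dots>, x\<^bsub>i-1\<^esub>, x\<^bsub>i+1\<^esub>, \<dots>, x\<^bsub>n+1\<^esub>)\<close>, in multiplicative notation.
\<close>
definition as_delta ::
    "'a topology \<Rightarrow> ('g, 'm) monoid_scheme \<Rightarrow> nat \<Rightarrow> ('a list \<Rightarrow> 'g) \<Rightarrow> ('a list \<Rightarrow> 'g)" where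
  "as_delta X G n \<phi> =
     (\<lambda>xs\<in>as_simplices X (Suc n).
        finprod G (\<lambda>i. if even i then \<phi> (omit_vertex i xs) else inv\<^bsub>G\<^esub> \<phi> (omit_vertex i xs))
          {..Suc n})"

text \<open>
  A homomorphism \<open>f\<close> carrying a normal subgroup \<open>M\<close> of the domain into a normal subgroup \<open>N\<close>
  of \<open>H\<close> sends a coset \<open>K\<close> of \<open>M\<close> into a single coset of \<open>N\<close>, namely \<open>N \<cdot> f(K)\<close>.
\<close>
definition quotient_map_on_cosets ::
    "('b, 'm) monoid_scheme \<Rightarrow> 'b set \<Rightarrow> ('a \<Rightarrow> 'b) \<Rightarrow> 'a set \<Rightarrow> 'b set" where
  "quotient_map_on_cosets H N f K = N <#>\<^bsub>H\<^esub> (f ` K)"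

definition as_coboundary ::
    "'a topology \<Rightarrow> ('g, 'm) monoid_scheme \<Rightarrow> nat
      \<Rightarrow> ('a list \<Rightarrow> 'g) set \<Rightarrow> ('a list \<Rightarrow> 'g) set" where
  "as_coboundary X G n =
     quotient_map_on_cosets (as_cochain_group X G (Suc n)) (as_locally_zero X G (Suc n))
       (as_delta X G n)"

definition as_cocycles ::
    "'a topology \<Rightarrow> ('g, 'm) monoid_scheme \<Rightarrow> nat \<Rightarrow> ('a list \<Rightarrow> 'g) set set" where
  "as_cocycles X G n = kernel (as_complex X G n) (as_complex X G (Suc n)) (as_coboundary X G n)"

definition as_coboundaries ::
    "'a topology \<Rightarrow> ('g, 'm) monoid_scheme \<Rightarrow> nat \<Rightarrow> ('a list \<Rightarrow> 'g) set set" where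
  "as_coboundaries X G n =
     (case n of 0 \<Rightarrow> {\<one>\<^bsub>as_complex X G 0\<^esub>}
      | Suc m \<Rightarrow> as_coboundary X G m ` carrier (as_complex X G m))"

definition as_cocycle_group ::
    "'a topology \<Rightarrow> ('g, 'm) monoid_scheme \<Rightarrow> nat \<Rightarrow> ('a list \<Rightarrow> 'g) set monoid" where
  "as_cocycle_group X G n = (as_complex X G n)\<lparr>carrier := as_cocycles X G n\<rparr>"

definition as_cohomology ::
    "'a topology \<Rightarrow> ('g, 'm) monoid_scheme \<Rightarrow> nat \<Rightarrow> ('a list \<Rightarrow> 'g) set set monoid" where
  "as_cohomology X G n = as_cocycle_group X G n Mod as_coboundaries X G n"

definition as_cochain_pullback ::
    "'a topology \<Rightarrow> nat \<Rightarrow> ('a \<Rightarrow> 'b) \<Rightarrow> ('b list \<Rightarrow> 'g) \<Rightarrow> ('a list \<Rightarrow> 'g)" where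
  "as_cochain_pullback X n f \<phi> = (\<lambda>xs\<in>as_simplices X n. \<phi> (map f xs))"

definition as_complex_pullback ::
    "'a topology \<Rightarrow> ('g, 'm) monoid_scheme \<Rightarrow> nat \<Rightarrow> ('a \<Rightarrow> 'b)
      \<Rightarrow> ('b list \<Rightarrow> 'g) set \<Rightarrow> ('a list \<Rightarrow> 'g) set" where
  "as_complex_pullback X G n f =
     quotient_map_on_cosets (as_cochain_group X G n) (as_locally_zero X G n)
       (as_cochain_pullback X n f)"

text \<open>
  The component \<open>f\<^sup>* : H\<^sup>n(Y;G) \<rightarrow> H\<^sup>n(X;G)\<close> in degree \<open>n\<close>, for continuous \<open>f : X \<rightarrow> Y\<close>. It is made
  extensional on \<open>H\<^sup>n(Y;G)\<close>, so that equality in HOL is equality of maps on \<open>H\<^sup>n(Y;G)\<close>.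
\<close>
definition as_induced ::
    "'a topology \<Rightarrow> 'b topology \<Rightarrow> ('g, 'm) monoid_scheme \<Rightarrow> ('a \<Rightarrow> 'b) \<Rightarrow> nat
      \<Rightarrow> ('b list \<Rightarrow> 'g) set set \<Rightarrow> ('a list \<Rightarrow> 'g) set set" where
  "as_induced X Y G f n =
     restrict
       (quotient_map_on_cosets (as_cocycle_group X G n) (as_coboundaries X G n)
          (as_complex_pullback X G n f))
       (carrier (as_cohomology Y G n))"

end

theory Submission
  imports Defs
begin

text \<open>
  Both \<open>X\<close> and \<open>T\<close> are the comb in the plane whose base is the ray \<open>y = 0\<close>, \<open>x > 0\<close> and whose
  vertical teeth stand at \<open>x = 1/(n+1)\<close> and at \<open>x = 0\<close>; the corner \<open>(0, 0)\<close>, where the limit tooth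
  would meet the base, is removed. As a closed set minus a point the comb is locally compact. It
  is connected, since the part \<open>x > 0\<close> is connected and dense. But in every compact subset the
  limit tooth is cut off from the base: teeth close to it are joined to each other only through
  the base near the missing corner. This is the failure of compactness that lets a slice class
  change along a connected parameter space.

  A one-dimensional class on the comb arises by assigning an element of \<open>G\<close> to each tooth. Near
  the limit tooth one uses the coboundary of this function of the teeth, and everywhere else the
  zero cochain; the two descriptions agree where both apply, because the function is constant on
  each single tooth. If the values of the teeth do not become constant towards the limit tooth,
  the class is nonzero: a function trivializing it would be constant on the connected part \<open>x > 0\<close>,
  hence equal on neighbouring teeth, where the cocycle sees different values.

  Let \<open>\<alpha>\<close> be the function on teeth that is \<open>h \<noteq> 0\<close> on every second tooth and zero on the others. On
  the product, the tooth at \<open>x\<close> and the tooth at \<open>u\<close> of the parameter comb receive \<open>\<alpha>(x)\<close> if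
  \<open>u \<le> x\<close> and \<open>0\<close> otherwise (\<open>staircase\<close>). For fixed \<open>u > 0\<close> only the finitely many teeth
  with \<open>x \<ge> u\<close> carry a nonzero value, so the slice classes vanish; as \<open>u\<close> tends to \<open>0\<close> for a
  fixed \<open>x > 0\<close> the value stabilizes at \<open>\<alpha>(x)\<close>. Hence the staircase function is locally constant except
  near pairs of limit points, its coboundary there extends by zero to a cocycle on the whole
  product (\<open>staircase_locally_constant\<close>, \<open>truncated_coboundary_cocycle\<close>), and the slice over a
  point of the limit tooth carries the nonzero class of \<open>\<alpha>\<close>. Over the point \<open>r = (1, 0)\<close> of the
  base the cocycle is even identically zero (\<open>staircase_cocycle_trivial_slice\<close>), whereas over
  \<open>s = (0, 1)\<close> it is not a coboundary (\<open>staircase_cocycle_nontrivial_slice\<close>).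

  The lemma \<open>as_induced_neq\<close> translates these facts about individual cochains into the inequality of the
  induced maps, which are maps between cosets of cosets.
\<close>

section \<open>Cochains modulo locally zero cochains\<close>

lemma as_locally_zeroI:
  assumes "\<phi> \<in> carrier (as_cochain_group X G n)"
    and "\<And>x. x \<in> topspace X \<Longrightarrow>
           \<exists>U. openin X U \<and> x \<in> U \<and> (\<forall>xs\<in>as_simplices X n. set xs \<subseteq> U \<longrightarrow> \<phi> xs = \<one>\<^bsub>G\<^esub>)"
  shows "\<phi> \<in> as_locally_zero X G n"
proof -
  let ?U = "{U. openin X U \<and> (\<forall>xs\<in>as_simplices X n. set xs \<subseteq> U \<longrightarrow> \<phi> xs = \<one>\<^bsub>G\<^esub>)}"
  have "\<Union>?U = topspace X"
  proof
    show "\<Union>?U \<subseteq> topspace X"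
      using openin_subset by fastforce
    show "topspace X \<subseteq> \<Union>?U"
      using assms(2) by blast
  qed
  then show ?thesis
    unfolding as_locally_zero_def using assms(1)
    by (intro CollectI conjI exI[of _ ?U]) simp_all
qed

lemma as_locally_zeroD:
  assumes "\<phi> \<in> as_locally_zero X G n" "x \<in> topspace X"
  shows "\<exists>U. openin X U \<and> x \<in> U \<and> (\<forall>xs\<in>as_simplices X n. set xs \<subseteq> U \<longrightarrow> \<phi> xs = \<one>\<^bsub>G\<^esub>)"
proof -
  obtain \<U> where \<U>: "\<forall>U\<in>\<U>. openin X U" "\<Union>\<U> = topspace X"
      "\<forall>U\<in>\<U>. \<forall>xs\<in>as_simplices X n. set xs \<subseteq> U \<longrightarrow> \<phi> xs = \<one>\<^bsub>G\<^esub>"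
    using assms(1) unfolding as_locally_zero_def mem_Collect_eq by (elim conjE exE) rule
  then obtain U where "U \<in> \<U>" "x \<in> U"
    using assms(2) by blast
  with \<U>(1,3) show ?thesis by (intro exI[of _ U]) simp
qed

lemma as_cochain_group_simps:
  "carrier (as_cochain_group X G n) = (\<Pi>\<^sub>E xs\<in>as_simplices X n. carrier G)"
  "\<phi> \<otimes>\<^bsub>as_cochain_group X G n\<^esub> \<psi> = (\<lambda>xs\<in>as_simplices X n. \<phi> xs \<otimes>\<^bsub>G\<^esub> \<psi> xs)"
  "\<one>\<^bsub>as_cochain_group X G n\<^esub> = (\<lambda>xs\<in>as_simplices X n. \<one>\<^bsub>G\<^esub>)"
  by (simp_all add: as_cochain_group_def)

lemma group_as_cochain_group: "group G \<Longrightarrow> group (as_cochain_group X G n)"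
  by (simp add: as_cochain_group_def)

lemma subgroup_as_locally_zero:
  assumes "group G"
  shows "subgroup (as_locally_zero X G n) (as_cochain_group X G n)"
proof -
  interpret group G by fact
  interpret H: group "as_cochain_group X G n" by (rule group_as_cochain_group) fact
  show ?thesis
  proof (rule H.subgroupI)
    show "as_locally_zero X G n \<subseteq> carrier (as_cochain_group X G n)"
      by (auto simp: as_locally_zero_def)
    have "\<one>\<^bsub>as_cochain_group X G n\<^esub> \<in> as_locally_zero X G n"
      by (rule as_locally_zeroI[OF H.one_closed])
        (auto simp: as_cochain_group_simps intro: exI[of _ "topspace X"])
    then show "as_locally_zero X G n \<noteq> {}" by blast
  next
    fix \<phi> assume \<phi>: "\<phi> \<in> as_locally_zero X G n"
    then have c: "\<phi> \<in> carrier (as_cochain_group X G n)" by (simp add: as_locally_zero_def)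
    show "inv\<^bsub>as_cochain_group X G n\<^esub> \<phi> \<in> as_locally_zero X G n"
    proof (rule as_locally_zeroI)
      show "inv\<^bsub>as_cochain_group X G n\<^esub> \<phi> \<in> carrier (as_cochain_group X G n)"
        using c by simp
      fix x assume "x \<in> topspace X"
      obtain U where "openin X U" "x \<in> U"
        "\<And>xs. xs \<in> as_simplices X n \<Longrightarrow> set xs \<subseteq> U \<Longrightarrow> \<phi> xs = \<one>\<^bsub>G\<^esub>"
        using as_locally_zeroD[OF \<phi> \<open>x \<in> topspace X\<close>] by blast
      then show "\<exists>U. openin X U \<and> x \<in> U \<and> (\<forall>xs\<in>as_simplices X n. set xs \<subseteq> U \<longrightarrow>
          (inv\<^bsub>as_cochain_group X G n\<^esub> \<phi>) xs = \<one>\<^bsub>G\<^esub>)"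
        using c by (intro exI[of _ U])
          (auto simp: as_cochain_group_def inv_product_group[where G="\<lambda>_. G", OF _ \<open>group G\<close>])
    qed
  next
    fix \<phi> \<psi> assume \<phi>: "\<phi> \<in> as_locally_zero X G n" and \<psi>: "\<psi> \<in> as_locally_zero X G n"
    then have c: "\<phi> \<in> carrier (as_cochain_group X G n)" "\<psi> \<in> carrier (as_cochain_group X G n)"
      by (simp_all add: as_locally_zero_def)
    show "\<phi> \<otimes>\<^bsub>as_cochain_group X G n\<^esub> \<psi> \<in> as_locally_zero X G n"
    proof (rule as_locally_zeroI)
      show "\<phi> \<otimes>\<^bsub>as_cochain_group X G n\<^esub> \<psi> \<in> carrier (as_cochain_group X G n)"
        using c by simp
      fix x assume x: "x \<in> topspace X"
      obtain U where "openin X U" "x \<in> U"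
        "\<And>xs. xs \<in> as_simplices X n \<Longrightarrow> set xs \<subseteq> U \<Longrightarrow> \<phi> xs = \<one>\<^bsub>G\<^esub>"
        using as_locally_zeroD[OF \<phi> x] by blast
      moreover obtain V where "openin X V" "x \<in> V"
        "\<And>xs. xs \<in> as_simplices X n \<Longrightarrow> set xs \<subseteq> V \<Longrightarrow> \<psi> xs = \<one>\<^bsub>G\<^esub>"
        using as_locally_zeroD[OF \<psi> x] by blast
      ultimately show "\<exists>U. openin X U \<and> x \<in> U \<and> (\<forall>xs\<in>as_simplices X n. set xs \<subseteq> U \<longrightarrow>
          (\<phi> \<otimes>\<^bsub>as_cochain_group X G n\<^esub> \<psi>) xs = \<one>\<^bsub>G\<^esub>)"
        by (intro exI[of _ "U \<inter> V"]) (auto simp: as_cochain_group_simps)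
    qed
  qed
qed

lemma (in group) subgroup_set_mult_absorb:
  assumes "subgroup N G" "S \<subseteq> N" "S \<noteq> {}"
  shows "N <#> S = N"
proof -
  have "N <#> S = (\<Union>s\<in>S. N #> s)"
    by (auto simp: set_mult_def r_coset_def)
  also have "\<dots> = (\<Union>s\<in>S. N)"
    using assms by (intro SUP_cong refl coset_join2) (auto dest: subgroup.subset)
  finally show ?thesis using assms(3) by simp
qed

lemma set_multI: "h \<in> H \<Longrightarrow> k \<in> K \<Longrightarrow> h \<otimes>\<^bsub>G\<^esub> k \<in> H <#>\<^bsub>G\<^esub> K"
  by (auto simp: set_mult_def)

lemma omit_vertex_in_as_simplices:
  assumes "xs \<in> as_simplices X (Suc n)" "i \<le> Suc n"
  shows "omit_vertex i xs \<in> as_simplices X n"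
  using assms set_take_subset[of i xs] set_drop_subset[of "Suc i" xs]
  by (fastforce simp: as_simplices_def omit_vertex_def)

lemma set_omit_vertex_subset: "set (omit_vertex i xs) \<subseteq> set xs"
  using set_take_subset[of i xs] set_drop_subset[of "Suc i" xs] by (auto simp: omit_vertex_def)

lemma map_omit_vertex: "map f (omit_vertex i xs) = omit_vertex i (map f xs)"
  by (simp add: omit_vertex_def take_map drop_map)

lemma as_delta_terms_closed:
  assumes "comm_group G" "\<phi> \<in> carrier (as_cochain_group X G n)" "xs \<in> as_simplices X (Suc n)"
  shows "(\<lambda>i. if even i then \<phi> (omit_vertex i xs) else inv\<^bsub>G\<^esub> \<phi> (omit_vertex i xs))
           \<in> {..Suc n} \<rightarrow> carrier G"
proof -
  interpret comm_group G by fact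
  have "\<phi> (omit_vertex i xs) \<in> carrier G" if "i \<le> Suc n" for i
    using assms(2) omit_vertex_in_as_simplices[OF assms(3) that]
    by (auto simp: as_cochain_group_simps PiE_iff)
  then show ?thesis by auto
qed

lemma as_delta_closed:
  assumes "comm_group G" "\<phi> \<in> carrier (as_cochain_group X G n)"
  shows "as_delta X G n \<phi> \<in> carrier (as_cochain_group X G (Suc n))"
proof -
  interpret comm_group G by fact
  show ?thesis
    unfolding as_delta_def as_cochain_group_simps
    by (intro restrict_PiE_iff[THEN iffD2] ballI finprod_closed as_delta_terms_closed[OF assms])
qed

lemma as_delta_mult:
  assumes "comm_group G"
    and "\<phi> \<in> carrier (as_cochain_group X G n)" "\<psi> \<in> carrier (as_cochain_group X G n)"
  shows "as_delta X G n (\<phi> \<otimes>\<^bsub>as_cochain_group X G n\<^esub> \<psi>)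
         = as_delta X G n \<phi> \<otimes>\<^bsub>as_cochain_group X G (Suc n)\<^esub> as_delta X G n \<psi>"
proof -
  interpret comm_group G by fact
  let ?t = "\<lambda>\<phi> xs i. if even i then \<phi> (omit_vertex i xs) else inv\<^bsub>G\<^esub> \<phi> (omit_vertex i xs)"
  have "finprod G (?t (\<phi> \<otimes>\<^bsub>as_cochain_group X G n\<^esub> \<psi>) xs) {..Suc n}
      = finprod G (?t \<phi> xs) {..Suc n} \<otimes>\<^bsub>G\<^esub> finprod G (?t \<psi> xs) {..Suc n}"
    if xs: "xs \<in> as_simplices X (Suc n)" for xs
  proof -
    note c = as_delta_terms_closed[OF assms(1,2) xs] as_delta_terms_closed[OF assms(1,3) xs]
    have "finprod G (?t (\<phi> \<otimes>\<^bsub>as_cochain_group X G n\<^esub> \<psi>) xs) {..Suc n}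
        = finprod G (\<lambda>i. ?t \<phi> xs i \<otimes>\<^bsub>G\<^esub> ?t \<psi> xs i) {..Suc n}"
    proof (rule finprod_cong')
      show "(\<lambda>i. ?t \<phi> xs i \<otimes>\<^bsub>G\<^esub> ?t \<psi> xs i) \<in> {..Suc n} \<rightarrow> carrier G"
        using c by (intro Pi_I m_closed) (blast dest: Pi_mem)+
      fix i assume "i \<in> {..Suc n}"
      then have i: "omit_vertex i xs \<in> as_simplices X n"
        using omit_vertex_in_as_simplices[OF xs] by simp
      then have "\<phi> (omit_vertex i xs) \<in> carrier G" "\<psi> (omit_vertex i xs) \<in> carrier G"
        using assms by (auto simp: as_cochain_group_simps PiE_iff)
      with i show "?t (\<phi> \<otimes>\<^bsub>as_cochain_group X G n\<^esub> \<psi>) xs i = ?t \<phi> xs i \<otimes>\<^bsub>G\<^esub> ?t \<psi> xs i"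
        by (simp add: as_cochain_group_simps inv_mult)
    qed simp
    also have "\<dots> = finprod G (?t \<phi> xs) {..Suc n} \<otimes>\<^bsub>G\<^esub> finprod G (?t \<psi> xs) {..Suc n}"
      using c by (rule finprod_multf)
    finally show ?thesis .
  qed
  then show ?thesis
    unfolding as_delta_def as_cochain_group_simps(2)[of X G "Suc n"]
    by (intro restrict_ext) (simp del: finprod_Suc)
qed

lemma as_delta_locally_zero:
  assumes "comm_group G" "\<phi> \<in> as_locally_zero X G n"
  shows "as_delta X G n \<phi> \<in> as_locally_zero X G (Suc n)"
proof -
  interpret comm_group G by fact
  have c: "\<phi> \<in> carrier (as_cochain_group X G n)"
    using assms(2) by (simp add: as_locally_zero_def)
  show ?thesis
  proof (rule as_locally_zeroI[OF as_delta_closed[OF assms(1) c]])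
    fix x assume x: "x \<in> topspace X"
    obtain U where U: "openin X U" "x \<in> U"
        "\<And>xs. xs \<in> as_simplices X n \<Longrightarrow> set xs \<subseteq> U \<Longrightarrow> \<phi> xs = \<one>\<^bsub>G\<^esub>"
      using as_locally_zeroD[OF assms(2) x] by blast
    have "as_delta X G n \<phi> xs = \<one>\<^bsub>G\<^esub>" if xs: "xs \<in> as_simplices X (Suc n)" "set xs \<subseteq> U" for xs
    proof -
      have "\<phi> (omit_vertex i xs) = \<one>\<^bsub>G\<^esub>" if "i \<in> {..Suc n}" for i
        using U(3) omit_vertex_in_as_simplices[OF xs(1), of i] set_omit_vertex_subset[of i xs] xs(2) that
        by auto
      then show ?thesis
        unfolding as_delta_def using xs(1)
        by (simp del: finprod_Suc) (rule finprod_one_eqI, simp)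
    qed
    with U show "\<exists>U. openin X U \<and> x \<in> U \<and>
        (\<forall>xs\<in>as_simplices X (Suc n). set xs \<subseteq> U \<longrightarrow> as_delta X G n \<phi> xs = \<one>\<^bsub>G\<^esub>)"
      by blast
  qed
qed

lemma map_in_as_simplices:
  "continuous_map X Y f \<Longrightarrow> xs \<in> as_simplices X n \<Longrightarrow> map f xs \<in> as_simplices Y n"
  using continuous_map_image_subset_topspace[of X Y f] by (auto simp: as_simplices_def)

lemma as_cochain_pullback_closed:
  assumes "continuous_map X Y f" "\<phi> \<in> carrier (as_cochain_group Y G n)"
  shows "as_cochain_pullback X n f \<phi> \<in> carrier (as_cochain_group X G n)"
  using assms map_in_as_simplices[OF assms(1), of _ n]
  by (auto simp: as_cochain_pullback_def as_cochain_group_simps PiE_iff)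

lemma as_cochain_pullback_mult:
  assumes "continuous_map X Y f"
  shows "as_cochain_pullback X n f (\<phi> \<otimes>\<^bsub>as_cochain_group Y G n\<^esub> \<psi>)
    = as_cochain_pullback X n f \<phi> \<otimes>\<^bsub>as_cochain_group X G n\<^esub> as_cochain_pullback X n f \<psi>"
  unfolding as_cochain_group_simps as_cochain_pullback_def
  using map_in_as_simplices[OF assms(1), of _ n] by (intro restrict_ext) auto

lemma as_cochain_pullback_delta:
  assumes "continuous_map X Y f" "comm_group G" "\<psi> \<in> carrier (as_cochain_group Y G n)"
  shows "as_cochain_pullback X (Suc n) f (as_delta Y G n \<psi>)
    = as_delta X G n (as_cochain_pullback X n f \<psi>)"
proof -
  interpret comm_group G by fact
  show ?thesis
    unfolding as_cochain_pullback_def[of X "Suc n"] as_delta_def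
  proof (rule restrict_ext)
    fix xs assume xs: "xs \<in> as_simplices X (Suc n)"
    let ?t = "\<lambda>\<phi> xs i. if even i then \<phi> (omit_vertex i xs) else inv\<^bsub>G\<^esub> \<phi> (omit_vertex i xs)"
    have "finprod G (?t \<psi> (map f xs)) {..Suc n}
        = finprod G (?t (as_cochain_pullback X n f \<psi>) xs) {..Suc n}"
      by (rule finprod_cong'[OF refl
          as_delta_terms_closed[OF assms(2) as_cochain_pullback_closed[OF assms(1,3)] xs]])
        (use omit_vertex_in_as_simplices[OF xs]
          in \<open>auto simp: as_cochain_pullback_def map_omit_vertex\<close>)
    then show "(\<lambda>xs\<in>as_simplices Y (Suc n). finprod G (?t \<psi> xs) {..Suc n}) (map f xs)
        = finprod G (?t (as_cochain_pullback X n f \<psi>) xs) {..Suc n}"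
      using map_in_as_simplices[OF assms(1) xs] by simp
  qed
qed

lemma as_cochain_pullback_locally_zero:
  assumes "continuous_map X Y f" "\<phi> \<in> as_locally_zero Y G n"
  shows "as_cochain_pullback X n f \<phi> \<in> as_locally_zero X G n"
proof (rule as_locally_zeroI)
  show "as_cochain_pullback X n f \<phi> \<in> carrier (as_cochain_group X G n)"
    using assms by (intro as_cochain_pullback_closed) (auto simp: as_locally_zero_def)
  fix x assume x: "x \<in> topspace X"
  then have fx: "f x \<in> topspace Y"
    using assms(1) by (auto simp: continuous_map_def)
  obtain U where U: "openin Y U" "f x \<in> U"
        "\<And>xs. xs \<in> as_simplices Y n \<Longrightarrow> set xs \<subseteq> U \<Longrightarrow> \<phi> xs = \<one>\<^bsub>G\<^esub>"
    using as_locally_zeroD[OF assms(2) fx] by blast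
  let ?V = "{x \<in> topspace X. f x \<in> U}"
  have "openin X ?V"
    using assms(1) U(1) by (simp add: continuous_map_def)
  moreover have "as_cochain_pullback X n f \<phi> xs = \<one>\<^bsub>G\<^esub>"
    if "xs \<in> as_simplices X n" "set xs \<subseteq> ?V" for xs
    using that U(3)[of "map f xs"] map_in_as_simplices[OF assms(1) that(1)]
    by (auto simp: as_cochain_pullback_def)
  ultimately show "\<exists>U. openin X U \<and> x \<in> U \<and>
      (\<forall>xs\<in>as_simplices X n. set xs \<subseteq> U \<longrightarrow> as_cochain_pullback X n f \<phi> xs = \<one>\<^bsub>G\<^esub>)"
    using x U(2) by (intro exI[of _ ?V]) auto
qed

section \<open>Detecting that two induced maps differ\<close>

lemma as_complex_simps:
  "carrier (as_complex X G n) = rcosets\<^bsub>as_cochain_group X G n\<^esub> (as_locally_zero X G n)"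
  "K \<otimes>\<^bsub>as_complex X G n\<^esub> L = K <#>\<^bsub>as_cochain_group X G n\<^esub> L"
  "\<one>\<^bsub>as_complex X G n\<^esub> = as_locally_zero X G n"
  by (simp_all add: as_complex_def FactGroup_def)

lemma as_cocycle_group_mult:
  "K \<otimes>\<^bsub>as_cocycle_group X G n\<^esub> L = K <#>\<^bsub>as_cochain_group X G n\<^esub> L"
  by (simp add: as_cocycle_group_def as_complex_simps)

lemma locally_zero_in_as_coboundaries:
  assumes "comm_group G"
  shows "as_locally_zero X G (Suc m) \<in> as_coboundaries X G (Suc m)"
proof -
  interpret comm_group G by fact
  interpret H: group "as_cochain_group X G m" by (rule group_as_cochain_group) (rule is_group)
  interpret H': group "as_cochain_group X G (Suc m)" by (rule group_as_cochain_group) (rule is_group)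
  note S = subgroup_as_locally_zero[OF is_group]
  have "as_locally_zero X G m = as_locally_zero X G m #>\<^bsub>as_cochain_group X G m\<^esub> \<one>\<^bsub>as_cochain_group X G m\<^esub>"
    using H.coset_mult_one[OF subgroup.subset[OF S]] by simp
  then have "as_locally_zero X G m \<in> carrier (as_complex X G m)"
    unfolding as_complex_simps RCOSETS_def by blast
  moreover have "as_coboundary X G m (as_locally_zero X G m) = as_locally_zero X G (Suc m)"
    unfolding as_coboundary_def quotient_map_on_cosets_def
    using as_delta_locally_zero[OF assms] subgroup.one_closed[OF S]
    by (intro H'.subgroup_set_mult_absorb S) blast+
  ultimately show ?thesis
    unfolding as_coboundaries_def by (auto simp: image_iff intro!: bexI)
qed

text \<open>
  Elements of \<open>as_coboundaries\<close> are whole cosets; this provides a cochain to calculate with.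
\<close>
lemma as_coboundaries_representative:
  assumes "comm_group G" "b \<in> as_coboundaries X G (Suc m)"
  obtains \<psi> where "\<psi> \<in> carrier (as_cochain_group X G m)" "as_delta X G m \<psi> \<in> b"
proof -
  interpret comm_group G by fact
  interpret H: group "as_cochain_group X G m" by (rule group_as_cochain_group) (rule is_group)
  interpret H': group "as_cochain_group X G (Suc m)" by (rule group_as_cochain_group) (rule is_group)
  note S = subgroup_as_locally_zero[OF is_group]
  obtain \<psi> where \<psi>: "\<psi> \<in> carrier (as_cochain_group X G m)"
    and b: "b = as_coboundary X G m (as_locally_zero X G m #>\<^bsub>as_cochain_group X G m\<^esub> \<psi>)"
    using assms(2) unfolding as_coboundaries_def as_complex_simps RCOSETS_def by auto
  have "\<psi> \<in> as_locally_zero X G m #>\<^bsub>as_cochain_group X G m\<^esub> \<psi>"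
    by (rule H.rcos_self[OF \<psi> S])
  moreover have "\<one>\<^bsub>as_cochain_group X G (Suc m)\<^esub> \<otimes>\<^bsub>as_cochain_group X G (Suc m)\<^esub> as_delta X G m \<psi>
      = as_delta X G m \<psi>"
    by (rule H'.l_one) (rule as_delta_closed[OF assms(1) \<psi>])
  ultimately have "as_delta X G m \<psi> \<in> b"
    unfolding b as_coboundary_def quotient_map_on_cosets_def
    by (metis set_multI[OF subgroup.one_closed[OF S] imageI])
  with \<psi> that show thesis by blast
qed

text \<open>
  The class of \<open>\<phi>\<close> itself separates the two maps. Its image under \<open>f\<^sup>*\<close> is a set of cosets that
  contains the coset of zero, because \<open>f\<close> pulls \<open>\<phi>\<close> back to a locally zero cochain. If \<open>g\<^sup>*\<close> had the same
  image, then the coset of zero would be the product of a coboundary on \<open>X\<close>, the pullback of a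
  coboundary on \<open>Y\<close>, and the pullback of \<open>\<phi>\<close>. Choosing representatives, and using that
  pullback commutes with the coboundary, makes the pullback of \<open>\<phi>\<close> along \<open>g\<close> a coboundary up to a
  locally zero cochain, contrary to the last hypothesis.
\<close>
lemma as_induced_neq:
  assumes G: "comm_group G" and f: "continuous_map X Y f" and g: "continuous_map X Y g"
    and \<phi>: "\<phi> \<in> carrier (as_cochain_group Y G (Suc m))"
    and cocycle: "as_delta Y G (Suc m) \<phi> \<in> as_locally_zero Y G (Suc (Suc m))"
    and f\<phi>: "as_cochain_pullback X (Suc m) f \<phi> \<in> as_locally_zero X G (Suc m)"
    and g\<phi>: "\<And>\<psi>. \<psi> \<in> carrier (as_cochain_group X G m) \<Longrightarrow>
        as_delta X G m \<psi> \<otimes>\<^bsub>as_cochain_group X G (Suc m)\<^esub> as_cochain_pullback X (Suc m) g \<phi>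
          \<notin> as_locally_zero X G (Suc m)"
  shows "as_induced X Y G f (Suc m) \<noteq> as_induced X Y G g (Suc m)"
proof
  assume eq: "as_induced X Y G f (Suc m) = as_induced X Y G g (Suc m)"
  interpret comm_group G by fact
  let ?n = "Suc m"
  let ?CX = "as_cochain_group X G ?n" and ?ZX = "as_locally_zero X G ?n"
  let ?CY = "as_cochain_group Y G ?n" and ?ZY = "as_locally_zero Y G ?n"
  interpret CX: group ?CX by (rule group_as_cochain_group) (rule is_group)
  interpret CY: group ?CY by (rule group_as_cochain_group) (rule is_group)
  interpret CX0: group "as_cochain_group X G m" by (rule group_as_cochain_group) (rule is_group)
  interpret CY': group "as_cochain_group Y G (Suc ?n)" by (rule group_as_cochain_group) (rule is_group)
  note S = subgroup_as_locally_zero[OF is_group]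
  have ZY_sub: "c \<in> carrier ?CY" if "c \<in> ?ZY" for c
    using that by (simp add: as_locally_zero_def)
  define \<kappa> where "\<kappa> = ?ZY #>\<^bsub>?CY\<^esub> \<phi>"
  define c where "c = as_coboundaries Y G ?n #>\<^bsub>as_cocycle_group Y G ?n\<^esub> \<kappa>"
  have \<phi>\<kappa>: "\<phi> \<in> \<kappa>"
    unfolding \<kappa>_def by (rule CY.rcos_self[OF \<phi> S])
  have \<kappa>E: "\<exists>z\<in>?ZY. \<eta> = z \<otimes>\<^bsub>?CY\<^esub> \<phi>" if "\<eta> \<in> \<kappa>" for \<eta>
    using that unfolding \<kappa>_def r_coset_def by blast
  have "as_delta Y G ?n ` \<kappa> \<subseteq> as_locally_zero Y G (Suc ?n)"
  proof
    fix \<zeta> assume "\<zeta> \<in> as_delta Y G ?n ` \<kappa>"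
    then obtain z where z: "z \<in> ?ZY" "\<zeta> = as_delta Y G ?n (z \<otimes>\<^bsub>?CY\<^esub> \<phi>)"
      using \<kappa>E by blast
    show "\<zeta> \<in> as_locally_zero Y G (Suc ?n)"
      unfolding z(2) as_delta_mult[OF G ZY_sub[OF z(1)] \<phi>]
      by (rule subgroup.m_closed[OF S as_delta_locally_zero[OF G z(1)] cocycle])
  qed
  then have "as_coboundary Y G ?n \<kappa> = as_locally_zero Y G (Suc ?n)"
    unfolding as_coboundary_def quotient_map_on_cosets_def
    using \<phi>\<kappa> by (intro CY'.subgroup_set_mult_absorb S) auto
  moreover have "\<kappa> \<in> carrier (as_complex Y G ?n)"
    unfolding as_complex_simps RCOSETS_def \<kappa>_def using \<phi> by blast
  ultimately have "\<kappa> \<in> as_cocycles Y G ?n"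
    unfolding as_cocycles_def kernel_def by (simp add: as_complex_simps)
  then have c: "c \<in> carrier (as_cohomology Y G ?n)"
    unfolding as_cohomology_def FactGroup_def RCOSETS_def c_def as_cocycle_group_def by auto
  have c_eq: "c = {b' <#>\<^bsub>?CY\<^esub> \<kappa> | b'. b' \<in> as_coboundaries Y G ?n}"
    by (auto simp: c_def r_coset_def as_cocycle_group_mult)
  have evaluate: "as_induced X Y G h ?n c
      = {b <#>\<^bsub>?CX\<^esub> as_complex_pullback X G ?n h (b' <#>\<^bsub>?CY\<^esub> \<kappa>) | b b'.
          b \<in> as_coboundaries X G ?n \<and> b' \<in> as_coboundaries Y G ?n}" for h
    unfolding as_induced_def restrict_apply'[OF c] quotient_map_on_cosets_def
    by (auto simp: set_mult_def[where G="as_cocycle_group X G ?n"] as_cocycle_group_mult c_eq)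
  have "?ZY <#>\<^bsub>?CY\<^esub> \<kappa> = \<kappa>"
    unfolding \<kappa>_def
    by (simp add: CY.setmult_rcos_assoc[OF subgroup.subset[OF S] subgroup.subset[OF S] \<phi>]
        CY.subgroup_mult_id[OF S])
  moreover have "as_complex_pullback X G ?n f \<kappa> = ?ZX"
  proof -
    have "as_cochain_pullback X ?n f ` \<kappa> \<subseteq> ?ZX"
    proof
      fix \<zeta> assume "\<zeta> \<in> as_cochain_pullback X ?n f ` \<kappa>"
      then obtain z where z: "z \<in> ?ZY" "\<zeta> = as_cochain_pullback X ?n f (z \<otimes>\<^bsub>?CY\<^esub> \<phi>)"
        using \<kappa>E by blast
      show "\<zeta> \<in> ?ZX"
        unfolding z(2) as_cochain_pullback_mult[OF f]
        by (rule subgroup.m_closed[OF S as_cochain_pullback_locally_zero[OF f z(1)] f\<phi>])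
    qed
    then show ?thesis
      unfolding as_complex_pullback_def quotient_map_on_cosets_def
      using \<phi>\<kappa> by (intro CX.subgroup_set_mult_absorb S) auto
  qed
  moreover have "?ZX <#>\<^bsub>?CX\<^esub> ?ZX = ?ZX"
    by (rule CX.subgroup_mult_id[OF S])
  ultimately have "?ZX \<in> as_induced X Y G f ?n c"
    unfolding evaluate
    using locally_zero_in_as_coboundaries[OF G, of X m] locally_zero_in_as_coboundaries[OF G, of Y m]
    by (intro CollectI exI[of _ ?ZX] exI[of _ ?ZY]) simp
  then have "?ZX \<in> as_induced X Y G g ?n c"
    using eq by simp
  then obtain b b' where b: "b \<in> as_coboundaries X G ?n" and b': "b' \<in> as_coboundaries Y G ?n"
    and ZX: "?ZX = b <#>\<^bsub>?CX\<^esub> as_complex_pullback X G ?n g (b' <#>\<^bsub>?CY\<^esub> \<kappa>)"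
    unfolding evaluate by blast
  obtain \<psi> where \<psi>: "\<psi> \<in> carrier (as_cochain_group X G m)" "as_delta X G m \<psi> \<in> b"
    using as_coboundaries_representative[OF G b] .
  obtain \<psi>' where \<psi>': "\<psi>' \<in> carrier (as_cochain_group Y G m)" "as_delta Y G m \<psi>' \<in> b'"
    using as_coboundaries_representative[OF G b'] .
  let ?\<eta> = "as_delta Y G m \<psi>' \<otimes>\<^bsub>?CY\<^esub> \<phi>"
  have \<eta>: "?\<eta> \<in> b' <#>\<^bsub>?CY\<^esub> \<kappa>"
    by (rule set_multI[OF \<psi>'(2) \<phi>\<kappa>])
  have \<eta>c: "as_cochain_pullback X ?n g ?\<eta> \<in> carrier ?CX"
    by (intro as_cochain_pullback_closed[OF g] CY.m_closed as_delta_closed[OF G \<psi>'(1)] \<phi>)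
  have "\<one>\<^bsub>?CX\<^esub> \<otimes>\<^bsub>?CX\<^esub> as_cochain_pullback X ?n g ?\<eta>
      \<in> as_complex_pullback X G ?n g (b' <#>\<^bsub>?CY\<^esub> \<kappa>)"
    unfolding as_complex_pullback_def quotient_map_on_cosets_def
    by (intro set_multI subgroup.one_closed[OF S] imageI \<eta>)
  then have "as_delta X G m \<psi> \<otimes>\<^bsub>?CX\<^esub> as_cochain_pullback X ?n g ?\<eta> \<in> ?ZX"
    unfolding CX.l_one[OF \<eta>c] by (subst ZX) (rule set_multI[OF \<psi>(2)])
  moreover have "as_delta X G m \<psi> \<otimes>\<^bsub>?CX\<^esub> as_cochain_pullback X ?n g ?\<eta>
      = as_delta X G m (\<psi> \<otimes>\<^bsub>as_cochain_group X G m\<^esub> as_cochain_pullback X m g \<psi>')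
          \<otimes>\<^bsub>?CX\<^esub> as_cochain_pullback X ?n g \<phi>"
    unfolding as_cochain_pullback_mult[OF g] as_cochain_pullback_delta[OF g G \<psi>'(1)]
      as_delta_mult[OF G \<psi>(1) as_cochain_pullback_closed[OF g \<psi>'(1)]]
    by (rule CX.m_assoc[symmetric])
      (intro as_delta_closed[OF G] as_cochain_pullback_closed[OF g] \<psi> \<psi>' \<phi>)+
  ultimately show False
    using g\<phi>[OF CX0.m_closed[OF \<psi>(1) as_cochain_pullback_closed[OF g \<psi>'(1)]]] by simp
qed


section \<open>Coboundaries truncated to an open set\<close>

lemma as_delta_edge:
  assumes "comm_group G" "\<psi> \<in> carrier (as_cochain_group X G 0)" "a \<in> topspace X" "b \<in> topspace X"
  shows "as_delta X G 0 \<psi> [a, b] = inv\<^bsub>G\<^esub> \<psi> [a] \<otimes>\<^bsub>G\<^esub> \<psi> [b]"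
proof -
  interpret comm_group G by fact
  let ?t = "\<lambda>i. if even i then \<psi> (omit_vertex i [a, b]) else inv\<^bsub>G\<^esub> \<psi> (omit_vertex i [a, b])"
  have ab: "[a, b] \<in> as_simplices X (Suc 0)"
    using assms by (simp add: as_simplices_def)
  have t: "?t \<in> {..Suc 0} \<rightarrow> carrier G"
    by (rule as_delta_terms_closed[OF assms(1,2) ab])
  have t0: "?t \<in> {0} \<rightarrow> carrier G"
    by (rule Pi_anti_mono[THEN subsetD, OF _ t]) simp
  show ?thesis
    unfolding as_delta_def restrict_apply'[OF ab] finprod_Suc[OF t] finprod_0[OF t0]
    by (simp add: omit_vertex_def)
qed

lemma as_delta_triangle:
  assumes "comm_group G" "\<phi> \<in> carrier (as_cochain_group X G (Suc 0))"
    and "a \<in> topspace X" "b \<in> topspace X" "c \<in> topspace X"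
  shows "as_delta X G (Suc 0) \<phi> [a, b, c]
    = \<phi> [a, b] \<otimes>\<^bsub>G\<^esub> (inv\<^bsub>G\<^esub> \<phi> [a, c] \<otimes>\<^bsub>G\<^esub> \<phi> [b, c])"
proof -
  interpret comm_group G by fact
  let ?t = "\<lambda>i. if even i then \<phi> (omit_vertex i [a, b, c]) else inv\<^bsub>G\<^esub> \<phi> (omit_vertex i [a, b, c])"
  have abc: "[a, b, c] \<in> as_simplices X (Suc (Suc 0))"
    using assms by (simp add: as_simplices_def)
  have t: "?t \<in> {..Suc (Suc 0)} \<rightarrow> carrier G"
    by (rule as_delta_terms_closed[OF assms(1,2) abc])
  have t1: "?t \<in> {..Suc 0} \<rightarrow> carrier G" and t0: "?t \<in> {0} \<rightarrow> carrier G"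
    by (rule Pi_anti_mono[THEN subsetD, OF _ t], simp)+
  show ?thesis
    unfolding as_delta_def restrict_apply'[OF abc] finprod_Suc[OF t] finprod_Suc[OF t1] finprod_0[OF t0]
    by (simp add: omit_vertex_def)
qed

text \<open>
  Cutting off the coboundary of \<open>F\<close> outside \<open>N\<close> is how a function given only on the open set \<open>N\<close>
  produces a cochain on all of \<open>X\<close>.
\<close>
definition truncated_coboundary ::
    "'a topology \<Rightarrow> ('g, 'm) monoid_scheme \<Rightarrow> 'a set \<Rightarrow> ('a \<Rightarrow> 'g) \<Rightarrow> ('a list \<Rightarrow> 'g)" where
  "truncated_coboundary X G N F =
     (\<lambda>xs\<in>as_simplices X (Suc 0).
        if set xs \<subseteq> N then inv\<^bsub>G\<^esub> F (xs ! 0) \<otimes>\<^bsub>G\<^esub> F (xs ! 1) else \<one>\<^bsub>G\<^esub>)"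

lemma truncated_coboundary_edge:
  assumes "a \<in> topspace X" "b \<in> topspace X"
  shows "truncated_coboundary X G N F [a, b] =
    (if a \<in> N \<and> b \<in> N then inv\<^bsub>G\<^esub> F a \<otimes>\<^bsub>G\<^esub> F b else \<one>\<^bsub>G\<^esub>)"
  using assms by (simp add: truncated_coboundary_def as_simplices_def)

lemma as_simplices_edgeE:
  assumes "xs \<in> as_simplices X (Suc 0)"
  obtains a b where "xs = [a, b]" "a \<in> topspace X" "b \<in> topspace X"
  using assms by (auto simp: as_simplices_def length_Suc_conv)

lemma truncated_coboundary_closed:
  assumes "group G" "\<And>x. F x \<in> carrier G"
  shows "truncated_coboundary X G N F \<in> carrier (as_cochain_group X G (Suc 0))"
proof -
  interpret group G by fact
  show ?thesis
    using assms(2) by (auto simp: truncated_coboundary_def as_cochain_group_simps)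
qed

lemma (in comm_group) coboundary_of_coboundary_triangle:
  assumes "A \<in> carrier G" "B \<in> carrier G" "C \<in> carrier G"
  shows "(inv A \<otimes> B) \<otimes> (inv (inv A \<otimes> C) \<otimes> (inv B \<otimes> C)) = \<one>"
proof -
  let ?P = "inv A \<otimes> B" and ?Q = "inv B \<otimes> C"
  have PQ: "?P \<in> carrier G" "?Q \<in> carrier G" using assms by auto
  have "B \<otimes> ?Q = C"
    using assms by (simp add: m_assoc[symmetric])
  then have "inv A \<otimes> C = ?P \<otimes> ?Q"
    using assms by (simp add: m_assoc)
  moreover have "?P \<otimes> (inv (?P \<otimes> ?Q) \<otimes> ?Q) = inv (?P \<otimes> ?Q) \<otimes> (?P \<otimes> ?Q)"
    by (rule m_lcomm) (simp_all add: PQ)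
  moreover have "\<dots> = \<one>"
    by (rule l_inv) (simp add: PQ)
  ultimately show ?thesis by simp
qed

text \<open>
  Being a cocycle is a local condition. On \<open>N\<close> the cochain is the coboundary of \<open>F\<close>; near a point
  outside \<open>N\<close> it is zero, since \<open>F\<close> takes a single value on the part of \<open>N\<close> that is nearby. In
  general it is not a coboundary, as \<open>F\<close> need not extend to a function that works
  near every point.
\<close>
lemma truncated_coboundary_cocycle:
  assumes G: "comm_group G" and N: "openin X N" and F: "\<And>x. F x \<in> carrier G"
    and const: "\<And>x. x \<in> topspace X - N \<Longrightarrow>
        \<exists>U. openin X U \<and> x \<in> U \<and> (\<forall>a\<in>U \<inter> N. \<forall>b\<in>U \<inter> N. F a = F b)"
  shows "as_delta X G (Suc 0) (truncated_coboundary X G N F) \<in> as_locally_zero X G (Suc (Suc 0))"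
proof (rule as_locally_zeroI)
  interpret comm_group G by fact
  let ?\<tau> = "truncated_coboundary X G N F"
  have \<tau>: "?\<tau> \<in> carrier (as_cochain_group X G (Suc 0))"
    by (rule truncated_coboundary_closed[OF is_group F])
  show "as_delta X G (Suc 0) ?\<tau> \<in> carrier (as_cochain_group X G (Suc (Suc 0)))"
    by (rule as_delta_closed[OF G \<tau>])
  fix x assume x: "x \<in> topspace X"
  obtain U where U: "openin X U" "x \<in> U"
    and cases: "U = N \<or> (\<forall>a\<in>U \<inter> N. \<forall>b\<in>U \<inter> N. F a = F b)"
    using N const x by (cases "x \<in> N") blast+
  have "as_delta X G (Suc 0) ?\<tau> xs = \<one>\<^bsub>G\<^esub>"
    if "xs \<in> as_simplices X (Suc (Suc 0))" and "set xs \<subseteq> U" for xs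
  proof -
    obtain a b c where xs: "xs = [a, b, c]"
      using \<open>xs \<in> as_simplices X (Suc (Suc 0))\<close> by (auto simp: as_simplices_def length_Suc_conv)
    then have abc: "a \<in> U" "b \<in> U" "c \<in> U" and
      top: "a \<in> topspace X" "b \<in> topspace X" "c \<in> topspace X"
      using that by (auto simp: as_simplices_def)
    show ?thesis
    proof (cases "U = N")
      case True
      with abc show ?thesis
        unfolding xs as_delta_triangle[OF G \<tau> top]
        by (simp add: top truncated_coboundary_edge coboundary_of_coboundary_triangle F)
    next
      case False
      then have *: "?\<tau> [u, v] = \<one>\<^bsub>G\<^esub>"
        if "u \<in> U" "v \<in> U" "u \<in> topspace X" "v \<in> topspace X" for u v
      proof -
        have "F u = F v" if "u \<in> N" "v \<in> N"
          using cases False that \<open>u \<in> U\<close> \<open>v \<in> U\<close> by blast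
        then show ?thesis using that F by (simp add: truncated_coboundary_edge)
      qed
      show ?thesis
        unfolding xs as_delta_triangle[OF G \<tau> top] by (simp add: * abc top)
    qed
  qed
  with U show "\<exists>U. openin X U \<and> x \<in> U \<and>
      (\<forall>xs\<in>as_simplices X (Suc (Suc 0)). set xs \<subseteq> U \<longrightarrow> as_delta X G (Suc 0) ?\<tau> xs = \<one>\<^bsub>G\<^esub>)"
    by blast
qed

section \<open>The punctured comb\<close>

definition comb_feet :: "real set" where
  "comb_feet = insert 0 (range (\<lambda>n. inverse (real (Suc n))))"

definition even_feet :: "real set" where
  "even_feet = (\<lambda>n. inverse (real (Suc n))) ` {n. even n}"

definition comb :: "(real \<times> real) set" where
  "comb = {z. 0 \<le> fst z \<and> 0 \<le> snd z \<and> z \<noteq> (0, 0) \<and> (snd z = 0 \<or> fst z \<in> comb_feet)}"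

definition comb_right :: "(real \<times> real) set" where
  "comb_right = {z \<in> comb. 0 < fst z}"

text \<open>
  The feet accumulate only at \<open>0\<close>, because only finitely many of them exceed \<open>x / 2\<close>. The foot \<open>x\<close>
  itself may or may not be present.
\<close>
lemma comb_feet_isolated:
  assumes "0 < x"
  shows "\<exists>d>0. \<forall>x'\<in>comb_feet. \<bar>x' - x\<bar> < d \<longrightarrow> x' = x"
proof -
  let ?S = "{x' \<in> comb_feet. x / 2 < x'}"
  have "n \<le> nat \<lceil>2 / x\<rceil>" if "x / 2 < inverse (real (Suc n))" for n
  proof -
    have "real (Suc n) * x < 2"
      using that by (simp add: field_simps)
    then have "real (Suc n) < 2 / x"
      using assms by (simp add: field_simps)
    then show ?thesis by linarith
  qed
  then have "?S \<subseteq> (\<lambda>n. inverse (real (Suc n))) ` {.. nat \<lceil>2 / x\<rceil>}"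
    using assms by (auto simp: comb_feet_def)
  then have "finite ?S" by (rule finite_subset) simp
  from finite_set_avoid[OF this, of x]
  obtain d where d: "0 < d" "\<And>x'. x' \<in> ?S \<Longrightarrow> x' \<noteq> x \<Longrightarrow> d \<le> dist x x'" by auto
  show ?thesis
  proof (intro exI[of _ "min d (x / 2)"] conjI ballI impI)
    show "0 < min d (x / 2)" using d(1) assms by simp
    fix x' assume x': "x' \<in> comb_feet" "\<bar>x' - x\<bar> < min d (x / 2)"
    then have "x' \<in> ?S" by (auto simp: abs_if split: if_splits)
    then show "x' = x" using d(2)[of x'] x'(2) by (auto simp: dist_real_def abs_minus_commute)
  qed
qed

lemma locally_compact_comb: "locally_compact_space (top_of_set comb)"
proof -
  let ?C = "({0..} \<times> {0..}) \<inter> (UNIV \<times> {0} \<union> comb_feet \<times> UNIV) :: (real \<times> real) set"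
  have "compact comb_feet"
    unfolding comb_feet_def by (rule compact_sequence_with_limit[OF LIMSEQ_inverse_real_of_nat])
  then have C: "closed ?C"
    by (intro closed_Int closed_Un closed_Times compact_imp_closed closed_atLeast closed_UNIV closed_singleton)
  have "locally_compact_space (top_of_set ?C)"
    using C by (intro locally_compact_space_closed_subset locally_compact_space_euclidean) simp
  moreover have "Hausdorff_space (top_of_set ?C)"
    by (simp add: Hausdorff_space_subtopology)
  moreover have "openin (top_of_set ?C) (?C \<inter> - {(0, 0)})"
    by (intro openin_open_Int open_Compl closed_singleton)
  ultimately have "locally_compact_space (subtopology (top_of_set ?C) (?C \<inter> - {(0, 0)}))"
    using locally_compact_space_open_subset by blast
  moreover have "?C \<inter> (?C \<inter> - {(0, 0)}) = comb"
    by (auto simp: comb_def)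
  ultimately show ?thesis by (simp add: subtopology_subtopology)
qed

text \<open>
  The base together with one tooth is connected, and these sets have the base in common.
\<close>
lemma connected_comb_right: "connected comb_right"
proof -
  let ?B = "{0<..} \<times> {0} :: (real \<times> real) set"
  let ?T = "\<lambda>n. {inverse (real (Suc n))} \<times> {0..} :: (real \<times> real) set"
  have "connected (?B \<union> ?T n)" for n
  proof (rule connected_Un)
    show "connected ?B" "connected (?T n)"
      by (intro connected_Times; simp)+
    have "(inverse (real (Suc n)), 0) \<in> ?B \<inter> ?T n" by simp
    then show "?B \<inter> ?T n \<noteq> {}" by blast
  qed
  moreover have "(1, 0) \<in> (\<Inter>n. ?B \<union> ?T n)" by simp
  ultimately have "connected (\<Union>n. ?B \<union> ?T n)"
    by (intro connected_Union) blast+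
  moreover have "(\<Union>n. ?B \<union> ?T n) = comb_right"
    by (auto simp: comb_right_def comb_def comb_feet_def)
  ultimately show ?thesis by simp
qed

text \<open>
  The limit tooth does not touch the base, but it lies in the closure of the other teeth.
\<close>
lemma connected_comb: "connected comb"
proof (rule connected_intermediate_closure[OF connected_comb_right])
  show "comb_right \<subseteq> comb" by (auto simp: comb_right_def)
  show "comb \<subseteq> closure comb_right"
  proof
    fix z assume z: "z \<in> comb"
    show "z \<in> closure comb_right"
    proof (cases "0 < fst z")
      case True
      with z show ?thesis using closure_subset[of comb_right] by (auto simp: comb_right_def)
    next
      case False
      with z have "z = (0, snd z)" by (auto simp: comb_def prod_eq_iff)
      moreover have "(\<lambda>n. (inverse (real (Suc n)), snd z)) \<longlonglongrightarrow> (0, snd z)"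
        by (intro tendsto_Pair LIMSEQ_inverse_real_of_nat tendsto_const)
      moreover have "(inverse (real (Suc n)), snd z) \<in> comb_right" for n
        using z by (auto simp: comb_right_def comb_def comb_feet_def)
      ultimately show ?thesis
        unfolding closure_sequential by metis
    qed
  qed
qed

section \<open>A class on the square of the comb that is not constant along slices\<close>

definition teeth_square :: "((real \<times> real) \<times> (real \<times> real)) set" where
  "teeth_square = {z \<in> comb \<times> comb. 0 < snd (fst z) \<and> 0 < snd (snd z)}"

text \<open>
  On a pair of teeth this is \<open>h\<close> when the first is one of the even teeth and the second is at least as
  close to the limit. The comparison \<open>u \<le> x\<close> makes the function depend on the order of the two
  limits \<open>x \<rightarrow> 0\<close> and \<open>u \<rightarrow> 0\<close>; the limit tooth \<open>x = 0\<close> is not among the even ones.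
\<close>
definition staircase :: "'g \<Rightarrow> 'g \<Rightarrow> (real \<times> real) \<times> (real \<times> real) \<Rightarrow> 'g" where
  "staircase e h z = (if fst (fst z) \<in> even_feet \<and> fst (snd z) \<le> fst (fst z) then h else e)"

text \<open>
  A pair outside \<open>teeth_square\<close> has a coordinate on the base, away from the corner, so that \<open>x > 0\<close> or
  \<open>u > 0\<close>. If \<open>x > 0\<close>, then nearby teeth of the first factor are all at \<open>x\<close>, and it remains to
  decide \<open>u \<le> x\<close> locally, where the tie \<open>u = x\<close> is settled by the isolation of \<open>x\<close> among the feet. If
  \<open>x = 0 < u\<close>, then \<open>u \<le> x\<close> fails nearby.
\<close>
lemma staircase_locally_constant:
  assumes "z \<in> comb \<times> comb - teeth_square"
  shows "\<exists>U. openin (top_of_set (comb \<times> comb)) U \<and> z \<in> U \<and>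
    (\<forall>a\<in>U \<inter> teeth_square. \<forall>b\<in>U \<inter> teeth_square. staircase e h a = staircase e h b)"
proof -
  obtain x y u v where z: "z = ((x, y), (u, v))" by (metis surj_pair)
  have pos: "0 \<le> x" "0 \<le> u" "0 < x \<or> 0 < u"
    using assms by (auto simp: z comb_def teeth_square_def)
  have feet: "fst (fst a) \<in> comb_feet" "fst (snd a) \<in> comb_feet" if "a \<in> teeth_square" for a
    using that by (auto simp: teeth_square_def comb_def)
  have "\<exists>W k. open W \<and> z \<in> W \<and> (\<forall>a\<in>W \<inter> teeth_square. staircase e h a = k)"
  proof (cases "0 < x")
    case True
    then obtain d where d: "0 < d" "\<forall>x'\<in>comb_feet. \<bar>x' - x\<bar> < d \<longrightarrow> x' = x"
      using comb_feet_isolated by blast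
    let ?V = "{a. \<bar>fst (fst a) - x\<bar> < d} :: ((real \<times> real) \<times> (real \<times> real)) set"
    have V: "open ?V"
      by (intro open_Collect_less continuous_intros)
    have zV: "z \<in> ?V"
      using d(1) by (simp add: z)
    have Vx: "fst (fst a) = x" if "a \<in> ?V" "a \<in> teeth_square" for a
      using d(2) feet(1)[OF that(2)] that(1) by simp
    consider "u < x" | "u = x" | "x < u" by linarith
    then show ?thesis
    proof cases
      case 1
      let ?W = "?V \<inter> {a. fst (snd a) < x}"
      have "open ?W" by (intro open_Int V open_Collect_less continuous_intros)
      moreover have "z \<in> ?W" using zV 1 by (simp add: z)
      moreover have "staircase e h a = (if x \<in> even_feet then h else e)"
        if "a \<in> ?W \<inter> teeth_square" for a
        using Vx[of a] that by (simp add: staircase_def)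
      ultimately show ?thesis by blast
    next
      case 2
      let ?W = "?V \<inter> {a. \<bar>fst (snd a) - x\<bar> < d}"
      have "open ?W" by (intro open_Int V open_Collect_less continuous_intros)
      moreover have "z \<in> ?W" using zV 2 d(1) by (simp add: z)
      moreover have "staircase e h a = (if x \<in> even_feet then h else e)"
        if a: "a \<in> ?W \<inter> teeth_square" for a
      proof -
        have "fst (snd a) = x"
          using d(2) feet(2)[of a] a by simp
        then show ?thesis using Vx[of a] a by (simp add: staircase_def)
      qed
      ultimately show ?thesis by blast
    next
      case 3
      let ?W = "?V \<inter> {a. x < fst (snd a)}"
      have "open ?W" by (intro open_Int V open_Collect_less continuous_intros)
      moreover have "z \<in> ?W" using zV 3 by (simp add: z)
      moreover have "staircase e h a = e" if "a \<in> ?W \<inter> teeth_square" for a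
        using Vx[of a] that by (simp add: staircase_def)
      ultimately show ?thesis by blast
    qed
  next
    case False
    let ?W = "{a. fst (fst a) < u / 2} \<inter> {a. u / 2 < fst (snd a)} :: ((real \<times> real) \<times> (real \<times> real)) set"
    have "open ?W" by (intro open_Int open_Collect_less continuous_intros)
    moreover have "z \<in> ?W" using False pos by (simp add: z)
    moreover have "staircase e h a = e" if "a \<in> ?W \<inter> teeth_square" for a
      using that by (simp add: staircase_def)
    ultimately show ?thesis by blast
  qed
  then obtain W k where W: "open W" "z \<in> W" "\<forall>a\<in>W \<inter> teeth_square. staircase e h a = k"
    by blast
  have "openin (top_of_set (comb \<times> comb)) ((comb \<times> comb) \<inter> W)"
    by (rule openin_open_Int[OF W(1)])
  moreover have "z \<in> (comb \<times> comb) \<inter> W"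
    using assms W(2) by blast
  ultimately show ?thesis
    using W(3) by (intro exI[of _ "(comb \<times> comb) \<inter> W"]) simp
qed

definition staircase_cocycle ::
    "('g, 'm) monoid_scheme \<Rightarrow> 'g \<Rightarrow> ((real \<times> real) \<times> (real \<times> real)) list \<Rightarrow> 'g" where
  "staircase_cocycle G h =
     truncated_coboundary (top_of_set (comb \<times> comb)) G teeth_square (staircase \<one>\<^bsub>G\<^esub> h)"

lemma staircase_cocycle:
  assumes "comm_group G" "h \<in> carrier G"
  shows "staircase_cocycle G h \<in> carrier (as_cochain_group (top_of_set (comb \<times> comb)) G (Suc 0))"
    and "as_delta (top_of_set (comb \<times> comb)) G (Suc 0) (staircase_cocycle G h)
      \<in> as_locally_zero (top_of_set (comb \<times> comb)) G (Suc (Suc 0))"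
proof -
  interpret comm_group G by fact
  have F: "staircase \<one>\<^bsub>G\<^esub> h z \<in> carrier G" for z
    using assms(2) by (simp add: staircase_def)
  show "staircase_cocycle G h \<in> carrier (as_cochain_group (top_of_set (comb \<times> comb)) G (Suc 0))"
    unfolding staircase_cocycle_def by (rule truncated_coboundary_closed[OF is_group F])
  let ?S = "{a. 0 < snd (fst a)} \<inter> {a. 0 < snd (snd a)} :: ((real \<times> real) \<times> (real \<times> real)) set"
  have "open ?S"
    by (intro open_Int open_Collect_less continuous_intros)
  moreover have "teeth_square = (comb \<times> comb) \<inter> ?S"
    unfolding teeth_square_def by blast
  ultimately have "openin (top_of_set (comb \<times> comb)) teeth_square"
    using openin_open_Int[of ?S "comb \<times> comb"] by argo
  then show "as_delta (top_of_set (comb \<times> comb)) G (Suc 0) (staircase_cocycle G h)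
      \<in> as_locally_zero (top_of_set (comb \<times> comb)) G (Suc (Suc 0))"
    unfolding staircase_cocycle_def
    by (rule truncated_coboundary_cocycle[OF assms(1) _ F]) (simp add: staircase_locally_constant)
qed

lemma comb_points: "(1, 0) \<in> comb" "(0, 1) \<in> comb"
proof -
  have "0 \<in> comb_feet" by (simp add: comb_feet_def)
  then show "(1, 0) \<in> comb" "(0, 1) \<in> comb" by (simp_all add: comb_def)
qed

lemma continuous_map_comb_slice:
  assumes "t \<in> comb"
  shows "continuous_map (top_of_set comb) (top_of_set (comb \<times> comb)) (\<lambda>x. (x, t))"
  using assms
  by (auto simp: continuous_map_subtopology_eu intro: continuous_on_Pair continuous_on_id continuous_on_const)

text \<open>
  The point \<open>(1, 0)\<close> is on the base, so the slice misses the set on which the cochain is supported.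
\<close>
lemma staircase_cocycle_trivial_slice:
  assumes "comm_group G"
  shows "as_cochain_pullback (top_of_set comb) (Suc 0) (\<lambda>x. (x, (1, 0))) (staircase_cocycle G h)
    \<in> as_locally_zero (top_of_set comb) G (Suc 0)"
proof -
  interpret comm_group G by fact
  have "as_cochain_pullback (top_of_set comb) (Suc 0) (\<lambda>x. (x, (1, 0))) (staircase_cocycle G h)
      = \<one>\<^bsub>as_cochain_group (top_of_set comb) G (Suc 0)\<^esub>"
    unfolding as_cochain_pullback_def as_cochain_group_simps
  proof (rule restrict_ext)
    fix xs assume "xs \<in> as_simplices (top_of_set comb) (Suc 0)"
    then obtain a b where "xs = [a, b]" "a \<in> comb" "b \<in> comb"
      by (rule as_simplices_edgeE) simp
    then show "staircase_cocycle G h (map (\<lambda>x. (x, (1, 0))) xs) = \<one>\<^bsub>G\<^esub>"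
      unfolding staircase_cocycle_def using comb_points
      by (simp add: truncated_coboundary_edge) (simp add: teeth_square_def)
  qed
  then show ?thesis
    using subgroup.one_closed[OF subgroup_as_locally_zero[OF is_group]] by simp
qed

text \<open>
  Over the limit tooth every \<open>x \<ge> 0\<close> satisfies \<open>u = 0 \<le> x\<close>, so the slice sees the full alternating
  function of the teeth. A function \<open>\<psi>\<close> trivializing the slice is locally constant, hence constant,
  on the connected part \<open>x > 0\<close>, since the cocycle vanishes on small sets there. Near \<open>(0, 1)\<close> it would
  nevertheless have to change by \<open>h\<close> between consecutive teeth.
\<close>
lemma staircase_cocycle_nontrivial_slice:
  assumes G: "comm_group G" and h: "h \<in> carrier G" "h \<noteq> \<one>\<^bsub>G\<^esub>"
    and \<psi>: "\<psi> \<in> carrier (as_cochain_group (top_of_set comb) G 0)"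
  shows "as_delta (top_of_set comb) G 0 \<psi> \<otimes>\<^bsub>as_cochain_group (top_of_set comb) G (Suc 0)\<^esub>
      as_cochain_pullback (top_of_set comb) (Suc 0) (\<lambda>x. (x, (0, 1))) (staircase_cocycle G h)
    \<notin> as_locally_zero (top_of_set comb) G (Suc 0)" (is "?\<omega> \<notin> _")
proof
  assume zero: "?\<omega> \<in> as_locally_zero (top_of_set comb) G (Suc 0)"
  interpret comm_group G by fact
  let ?e = "\<lambda>a. if fst a \<in> even_feet then h else \<one>\<^bsub>G\<^esub>"
  let ?\<tau> = "\<lambda>a b. if 0 < snd a \<and> 0 < snd b then inv\<^bsub>G\<^esub> ?e a \<otimes>\<^bsub>G\<^esub> ?e b else \<one>\<^bsub>G\<^esub>"
  have \<psi>_closed: "\<psi> [a] \<in> carrier G" if "a \<in> comb" for a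
    using \<psi> that by (auto simp: as_cochain_group_simps PiE_iff as_simplices_def)
  have \<omega>: "?\<omega> [a, b] = inv\<^bsub>G\<^esub> \<psi> [a] \<otimes>\<^bsub>G\<^esub> \<psi> [b] \<otimes>\<^bsub>G\<^esub> ?\<tau> a b" if "a \<in> comb" "b \<in> comb" for a b
  proof -
    have ab: "[a, b] \<in> as_simplices (top_of_set comb) (Suc 0)"
      using that by (simp add: as_simplices_def)
    have e: "staircase \<one>\<^bsub>G\<^esub> h (c, (0, 1)) = ?e c" if "c \<in> comb" for c
      using that by (simp add: staircase_def comb_def)
    have "staircase_cocycle G h [(a, (0, 1)), (b, (0, 1))] = ?\<tau> a b"
      unfolding staircase_cocycle_def using that comb_points
      by (simp add: truncated_coboundary_edge e) (auto simp: teeth_square_def)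
    then show ?thesis
      using ab that by (simp add: as_cochain_group_simps as_cochain_pullback_def as_delta_edge[OF G \<psi>])
  qed
  have near: "\<exists>S. open S \<and> z \<in> S \<and> (\<forall>a\<in>comb \<inter> S. \<forall>b\<in>comb \<inter> S.
      inv\<^bsub>G\<^esub> \<psi> [a] \<otimes>\<^bsub>G\<^esub> \<psi> [b] \<otimes>\<^bsub>G\<^esub> ?\<tau> a b = \<one>\<^bsub>G\<^esub>)" if z: "z \<in> comb" for z
  proof -
    obtain U where U: "openin (top_of_set comb) U" "z \<in> U"
        "\<forall>xs\<in>as_simplices (top_of_set comb) (Suc 0). set xs \<subseteq> U \<longrightarrow> ?\<omega> xs = \<one>\<^bsub>G\<^esub>"
      using as_locally_zeroD[OF zero, of z] z by auto
    then obtain S where S: "open S" "U = comb \<inter> S"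
      by (auto simp: openin_open)
    have "inv\<^bsub>G\<^esub> \<psi> [a] \<otimes>\<^bsub>G\<^esub> \<psi> [b] \<otimes>\<^bsub>G\<^esub> ?\<tau> a b = \<one>\<^bsub>G\<^esub>" if "a \<in> comb \<inter> S" "b \<in> comb \<inter> S" for a b
    proof -
      have "[a, b] \<in> as_simplices (top_of_set comb) (Suc 0)" "set [a, b] \<subseteq> U"
        using that S by (auto simp: as_simplices_def)
      then have "?\<omega> [a, b] = \<one>\<^bsub>G\<^esub>" using U(3) by blast
      then show ?thesis using \<omega>[of a b] that by simp
    qed
    then show ?thesis using S U(2) by (intro exI[of _ S]) blast
  qed
  have \<psi>_constant: "\<psi> [a] = \<psi> [b]" if "a \<in> comb_right" "b \<in> comb_right" for a b
  proof (rule connected_local_const[OF connected_comb_right that, of "\<lambda>a. \<psi> [a]"], rule ballI)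
    fix a assume "a \<in> comb_right"
    then have a: "a \<in> comb" "0 < fst a" by (auto simp: comb_right_def)
    obtain d where d: "0 < d" "\<forall>x'\<in>comb_feet. \<bar>x' - fst a\<bar> < d \<longrightarrow> x' = fst a"
      using comb_feet_isolated[OF a(2)] by blast
    obtain S where S: "open S" "a \<in> S" "\<forall>b\<in>comb \<inter> S. \<forall>c\<in>comb \<inter> S.
        inv\<^bsub>G\<^esub> \<psi> [b] \<otimes>\<^bsub>G\<^esub> \<psi> [c] \<otimes>\<^bsub>G\<^esub> ?\<tau> b c = \<one>\<^bsub>G\<^esub>"
      using near[OF a(1)] by blast
    let ?W = "S \<inter> {b. \<bar>fst b - fst a\<bar> < d}"
    have W: "open ?W" "a \<in> ?W"
      using S d(1) by (auto intro!: open_Int open_Collect_less continuous_intros)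
    have "\<psi> [a] = \<psi> [b]" if b: "b \<in> ?W" "b \<in> comb_right" for b
    proof -
      have bc: "b \<in> comb" using b by (simp add: comb_right_def)
      \<comment> \<open>if \<open>b\<close> is on a tooth, then that tooth is at the foot of \<open>a\<close>, so both have the same value\<close>
      have "?\<tau> a b = \<one>\<^bsub>G\<^esub>"
      proof (cases "0 < snd b")
        case True
        then have "fst b = fst a"
          using bc b(1) d(2) by (auto simp: comb_def)
        then show ?thesis using h by simp
      qed simp
      moreover have "inv\<^bsub>G\<^esub> \<psi> [a] \<otimes>\<^bsub>G\<^esub> \<psi> [b] \<otimes>\<^bsub>G\<^esub> ?\<tau> a b = \<one>\<^bsub>G\<^esub>"
        using S b(1) a(1) bc by blast
      ultimately have "inv\<^bsub>G\<^esub> \<psi> [a] \<otimes>\<^bsub>G\<^esub> \<psi> [b] = \<one>\<^bsub>G\<^esub>"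
        using \<psi>_closed[OF a(1)] \<psi>_closed[OF bc] by simp
      then show ?thesis
        using \<psi>_closed[OF a(1)] \<psi>_closed[OF bc] by (metis inv_closed inv_inv inv_equality inv_comm)
    qed
    then show "\<forall>\<^sub>F b in at a within comb_right. \<psi> [a] = \<psi> [b]"
      unfolding eventually_at_topological using W by blast
  qed
  obtain S where S: "open S" "(0, 1) \<in> S" "\<forall>b\<in>comb \<inter> S. \<forall>c\<in>comb \<inter> S.
      inv\<^bsub>G\<^esub> \<psi> [b] \<otimes>\<^bsub>G\<^esub> \<psi> [c] \<otimes>\<^bsub>G\<^esub> ?\<tau> b c = \<one>\<^bsub>G\<^esub>"
    using near[OF comb_points(2)] by blast
  \<comment> \<open>the points at height \<open>1\<close> of the teeth, which converge to \<open>(0, 1)\<close>\<close>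
  let ?q = "\<lambda>n. (inverse (real (Suc n)), 1 :: real)"
  have "?q \<longlonglongrightarrow> (0, 1)"
    by (intro tendsto_Pair LIMSEQ_inverse_real_of_nat tendsto_const)
  then have "\<forall>\<^sub>F n in sequentially. ?q n \<in> S"
    by (rule topological_tendstoD[OF _ S(1,2)])
  then obtain k where k: "\<forall>n\<ge>k. ?q n \<in> S"
    unfolding eventually_sequentially by blast
  have qS: "?q (2 * k) \<in> S" "?q (Suc (2 * k)) \<in> S"
    by (rule k[rule_format], simp)+
  have q: "?q n \<in> comb_right" "?q n \<in> comb" for n
    by (auto simp: comb_right_def comb_def comb_feet_def)
  have "fst (?q (2 * k)) \<in> even_feet"
    unfolding even_feet_def by (intro image_eqI[of _ _ "2 * k"]) simp_all
  moreover have "fst (?q (Suc (2 * k))) \<notin> even_feet"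
    by (auto simp: even_feet_def simp del: of_nat_Suc)
  moreover have "inv\<^bsub>G\<^esub> \<psi> [?q (2 * k)] \<otimes>\<^bsub>G\<^esub> \<psi> [?q (Suc (2 * k))] \<otimes>\<^bsub>G\<^esub> ?\<tau> (?q (2 * k)) (?q (Suc (2 * k))) = \<one>\<^bsub>G\<^esub>"
    using S(3) qS q(2) by blast
  ultimately have "inv\<^bsub>G\<^esub> \<psi> [?q (2 * k)] \<otimes>\<^bsub>G\<^esub> \<psi> [?q (Suc (2 * k))] \<otimes>\<^bsub>G\<^esub> inv\<^bsub>G\<^esub> h = \<one>\<^bsub>G\<^esub>"
    using h by simp
  moreover have "\<psi> [?q (Suc (2 * k))] = \<psi> [?q (2 * k)]"
    by (rule \<psi>_constant) (rule q)+
  ultimately have "inv\<^bsub>G\<^esub> h = \<one>\<^bsub>G\<^esub>"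
    using h \<psi>_closed[OF q(2)[of "2 * k"]] by simp
  then show False
    using h by (metis inv_inv inv_one)
qed

theorem theorem0p2:
  fixes p :: nat
  assumes "prime p"
  shows "\<exists>(X :: (real \<times> real) topology) (T :: (real \<times> real) topology) r s.
           locally_compact_space X \<and> Hausdorff_space X \<and> connected_space X \<and>
           locally_compact_space T \<and> Hausdorff_space T \<and> connected_space T \<and>
           r \<in> topspace T \<and> s \<in> topspace T \<and>
           (\<exists>n. as_induced X (prod_topology X T) (integer_mod_group p) (\<lambda>x. (x, r)) n
              \<noteq> as_induced X (prod_topology X T) (integer_mod_group p) (\<lambda>x. (x, s)) n)"
proof -
  let ?G = "integer_mod_group p" and ?X = "top_of_set comb"
  have G: "comm_group ?G" by simp
  have h: "1 \<in> carrier ?G" "1 \<noteq> \<one>\<^bsub>?G\<^esub>"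
    using assms by auto
  have "as_induced ?X (top_of_set (comb \<times> comb)) ?G (\<lambda>x. (x, (1, 0))) (Suc 0)
      \<noteq> as_induced ?X (top_of_set (comb \<times> comb)) ?G (\<lambda>x. (x, (0, 1))) (Suc 0)"
    by (rule as_induced_neq[OF G
          continuous_map_comb_slice[OF comb_points(1)] continuous_map_comb_slice[OF comb_points(2)]
          staircase_cocycle[OF G h(1)] staircase_cocycle_trivial_slice[OF G]
          staircase_cocycle_nontrivial_slice[OF G h]])
  then have "as_induced ?X (prod_topology ?X ?X) ?G (\<lambda>x. (x, (1, 0))) (Suc 0)
      \<noteq> as_induced ?X (prod_topology ?X ?X) ?G (\<lambda>x. (x, (0, 1))) (Suc 0)"
    by simp
  moreover have "Hausdorff_space ?X"
    by (simp add: Hausdorff_space_subtopology)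
  moreover have "connected_space ?X"
    using connected_comb by (simp add: connectedin_iff_connected[symmetric] connectedin_def)
  ultimately show ?thesis
    using locally_compact_comb comb_points
    by (intro exI[of _ ?X] exI[of _ "(1, 0)"] exI[of _ "(0, 1)"] conjI exI[of _ "Suc 0"]) simp_all
qed

end
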